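(* The two-dimensional Mordell-Gruber spectrum $\mathrm{MG}_2$ satisfies $$\left[\frac{83+18\sqrt2}{87+18\sqrt2},\,1\right]\subset\mathrm{MG}_2 .$$
   Context: A unimodular lattice in $\mathbb{R}^2$ is $\Lambda=\mathbb{Z}A+\mathbb{Z}B$ with $|\det(A;B)|=1$. A rectangle $[-x,x]\times[-y,y]$ ($x,y>0$) is admissible in $\Lambda$ if its only point in $\Lambda$ is $(0,0)$; the Mordell constant is $\kappa(\Lambda)=\sup xy$ over all admissible rectangles, and $\mathrm{MG}_2=\{\kappa(\Lambda):\Lambda\text{ a unimodular lattice in }\mathbb{R}^2\}$. *)

theory Defs
  imports "HOL-Analysis.Analysis"
begin

definition lattice_span :: "real^2 \<Rightarrow> real^2 \<Rightarrow> (real^2) set" where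
  "lattice_span A B = {of_int m *\<^sub>R A + of_int n *\<^sub>R B | m n :: int. True}"

definition unimodular_lattice :: "(real^2) set \<Rightarrow> bool" where
  "unimodular_lattice \<Lambda> \<longleftrightarrow>
     (\<exists>A B. \<bar>det (vector [A, B] :: real^2^2)\<bar> = 1 \<and> \<Lambda> = lattice_span A B)"

definition rectangle :: "real \<Rightarrow> real \<Rightarrow> (real^2) set" where
  "rectangle x y = cbox (vector [- x, - y]) (vector [x, y])"

definition admissible :: "(real^2) set \<Rightarrow> real \<Rightarrow> real \<Rightarrow> bool" where
  "admissible \<Lambda> x y \<longleftrightarrow> 0 < x \<and> 0 < y \<and> rectangle x y \<inter> \<Lambda> = {0}"

(* For a unimodular lattice the set below is nonempty (the lattice is discrete) and bounded
   above by 1 (Minkowski's convex body theorem), so the supremum in the reals is the genuine one. *)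
definition mordell_constant :: "(real^2) set \<Rightarrow> real" where
  "mordell_constant \<Lambda> = Sup {x * y | x y. admissible \<Lambda> x y}"

definition MG2 :: "real set" where
  "MG2 = {mordell_constant \<Lambda> | \<Lambda>. unimodular_lattice \<Lambda>}"

end

theory Submission
  imports Defs
begin

text \<open>
  A lattice with basis \<open>(p, q)\<close>, \<open>(-r, u)\<close>, where \<open>p > r > 0\<close>, \<open>u > q > 0\<close> and \<open>p u + q r = 1\<close>, has no nonzero point in the open box \<open>\<bar>x\<bar> < p\<close>, \<open>\<bar>y\<bar> < u\<close>, and
  \<open>p u = 1 / (1 + 1/(X Y))\<close> where \<open>X = p/r\<close> and \<open>Y = u/q\<close>. The other maximal empty boxes of the lattice
  come from the bases met on running the continued fractions of \<open>X\<close> and \<open>Y\<close>. So the Mordell constant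
  is \<open>s/(s+1)\<close>, where \<open>s\<close> is the supremum of
  \<open>[a\<^sub>k; a\<^sub>k\<^sub>+\<^sub>1, \<dots>] [a\<^sub>k\<^sub>-\<^sub>1; a\<^sub>k\<^sub>-\<^sub>2, \<dots>]\<close> over all places of a two-sided digit sequence.

  Take two adjacent digits \<open>a, b \<ge> 5\<close> differing by at most 1 and let all other digits be at most 4.
  Then the supremum is attained between \<open>a\<close> and \<open>b\<close>: a product taken elsewhere is smaller. Its value
  is \<open>(a + x) (b + y)\<close> with \<open>x, y\<close> in the Cantor set \<open>F(4)\<close> of continued fractions with digits at
  most 4, so everything reduces to a multiplicative form of Hall's theorem: for these \<open>a\<close> and \<open>b\<close> the
  set \<open>(a + F(4)) (b + F(4))\<close> is a full interval. The intervals for \<open>b = a\<close> and \<open>b = a + 1\<close> overlap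
  as \<open>a\<close> runs through \<open>5, 6, \<dots>\<close>, and together they cover the ray from \<open>(5 + min F(4))\<^sup>2\<close>, that is
  from \<open>(83 + 18 \<surd>2)/4\<close>, to infinity. The map \<open>s \<mapsto> s/(s+1)\<close> carries this ray onto the claimed
  interval without its right end 1, which is the constant of the integer lattice.

  Hall's theorem is proved by a gap argument (\<open>thick_sum\<close>): after taking logarithms, each finite-level
  approximation of \<open>a + F(4)\<close> is an interval from which gaps are removed one after the other, each
  no longer than the two pieces it leaves and no shorter than the gaps removed later from these
  pieces. That these length comparisons hold at every
  level, uniformly, rests on one fact about \<open>ln ((\<alpha> + \<beta> z)/(\<gamma> + \<delta> z))\<close>: the size
  of its derivative does not increase with \<open>z\<close>, but does not decrease when the derivative is taken in
  the coordinate \<open>-1/(1+z)\<close>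
  (\<open>log_moebius_contracts_upwards\<close> and \<open>log_moebius_expands_upwards\<close>). Compactness passes to
  \<open>F(4)\<close> (\<open>F4_product\<close>), and a descent along the two continued fractions bounds all empty boxes
  (\<open>F4_tail_bound\<close>).
\<close>

section \<open>Sums of thick sets\<close>

text \<open>
  \<open>thick S lo hi g\<close> records that \<open>S\<close> contains a set arising from the interval \<open>{lo..hi}\<close> by finitely many gap
  removals, the first gap having length \<open>g\<close> (and \<open>g = 0\<close> if there is none). A gap is no longer than
  either of the two pieces beside it, and no shorter than the first gaps of those pieces.\<close>

inductive thick :: "real set \<Rightarrow> real \<Rightarrow> real \<Rightarrow> real \<Rightarrow> bool" where
  base: "lo \<le> hi \<Longrightarrow> {lo..hi} \<subseteq> S \<Longrightarrow> thick S lo hi 0"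
| split: "thick S lo u g \<Longrightarrow> thick T v hi h \<Longrightarrow> u \<le> v \<Longrightarrow> g \<le> v - u \<Longrightarrow> h \<le> v - u \<Longrightarrow>
    v - u \<le> u - lo \<Longrightarrow> v - u \<le> hi - v \<Longrightarrow> thick (S \<union> T) lo hi (v - u)"

text \<open>
  If each hull is at least as long as the first gap of the other set, the sum of the hulls loses nothing.
  Remove the longer of the two first gaps: since it fits into the other hull, the two remaining sums of
  hulls still overlap or touch. The hypothesis passes to both new pairs, because the pieces are at least
  as long as the gap just removed, hence as the first gap of the other set, and their own first gaps
  are no longer than it.\<close>

lemma thick_sum:
  assumes "thick S a b g" "thick T c d h" "g \<le> d - c" "h \<le> b - a" "a + c \<le> s" "s \<le> b + d"
  shows "\<exists>x\<in>S. \<exists>y\<in>T. x + y = s"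
  using assms
proof (induction S a b g arbitrary: T c d h s rule: thick.induct)
  case (base a b S)
  note S = base(1,2)
  show ?case
    using base(3-)
  proof (induction T c d h arbitrary: s rule: thick.induct)
    case (base c d T)
    define x where "x = max a (s - d)"
    have "x \<in> {a..b}" "s - x \<in> {c..d}"
      using base S by (auto simp: x_def max_def)
    then have "x \<in> S" "s - x \<in> T" using S base by auto
    then show ?case by (metis add.commute diff_add_cancel)
  next
    case (split T c u g T' v d h)
    show ?case
    proof (cases "s \<le> b + u")
      case True
      have "\<exists>x\<in>S. \<exists>y\<in>T. x + y = s"
        by (rule split.IH(1)) (use split.prems split.hyps True in linarith)+
      then show ?thesis by blast
    next
      case False
      have "\<exists>x\<in>S. \<exists>y\<in>T'. x + y = s"
        by (rule split.IH(2)) (use split.prems split.hyps False in linarith)+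
      then show ?thesis by blast
    qed
  qed
next
  case (split S a u g S' v b g')
  note S = split.hyps and IH = split.IH
  \<comment> \<open>the case where the gap of the first set is the longer one\<close>
  have left: "\<exists>x\<in>S \<union> S'. \<exists>y\<in>T. x + y = s"
    if "thick T c d h" "v - u \<le> d - c" "h \<le> v - u" "a + c \<le> s" "s \<le> b + d" for T c d h s
  proof (cases "s \<le> u + d")
    case True
    have "\<exists>x\<in>S. \<exists>y\<in>T. x + y = s"
      by (rule IH(1)[OF that(1)]) (use S that True in linarith)+
    then show ?thesis by blast
  next
    case False
    have "\<exists>x\<in>S'. \<exists>y\<in>T. x + y = s"
      by (rule IH(2)[OF that(1)]) (use S that False in linarith)+
    then show ?thesis by blast
  qed
  show ?case
    using split.prems
  proof (induction T c d h arbitrary: s rule: thick.induct)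
    case (base c d T)
    show ?case
      by (rule left[OF thick.base[OF base(1,2)]]) (use base S in linarith)+
  next
    case (split T c u' g T' v' d h)
    show ?case
    proof (cases "v' - u' \<le> v - u")
      case True
      show ?thesis
        by (rule left[OF thick.split[OF split.hyps]]) (use split.prems True in linarith)+
    next
      case gap: False
      show ?thesis
      proof (cases "s \<le> b + u'")
        case True
        have "\<exists>x\<in>S \<union> S'. \<exists>y\<in>T. x + y = s"
          by (rule split.IH(1)) (use split.prems split.hyps gap True in linarith)+
        then show ?thesis by blast
      next
        case False
        have "\<exists>x\<in>S \<union> S'. \<exists>y\<in>T'. x + y = s"
          by (rule split.IH(2)) (use split.prems split.hyps gap False in linarith)+
        then show ?thesis by blast
      qed
    qed
  qed
qed

text \<open>
  Here the two ends come in either order, so that increasing and decreasing images of a Cantor set can be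
  treated alike.\<close>

definition thick_between :: "real set \<Rightarrow> real \<Rightarrow> real \<Rightarrow> real \<Rightarrow> bool" where
  "thick_between S e f g \<longleftrightarrow> thick S (min e f) (max e f) g"

lemma thick_between_commute: "thick_between S e f g \<longleftrightarrow> thick_between S f e g"
  by (simp add: thick_between_def min.commute max.commute)

lemma thick_between_split:
  assumes "thick_between S e u g" "thick_between T v f h"
    and "(e \<le> u \<and> u \<le> v \<and> v \<le> f) \<or> (f \<le> v \<and> v \<le> u \<and> u \<le> e)"
    and "g \<le> \<bar>v - u\<bar>" "h \<le> \<bar>v - u\<bar>" "\<bar>v - u\<bar> \<le> \<bar>u - e\<bar>" "\<bar>v - u\<bar> \<le> \<bar>f - v\<bar>"
  shows "thick_between (S \<union> T) e f \<bar>v - u\<bar>"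
  using assms(3)
proof
  assume *: "e \<le> u \<and> u \<le> v \<and> v \<le> f"
  then have "thick (S \<union> T) e f (v - u)"
    using assms by (intro thick.split[of S e u g T v f h]) (auto simp: thick_between_def)
  then show ?thesis using * by (simp add: thick_between_def)
next
  assume *: "f \<le> v \<and> v \<le> u \<and> u \<le> e"
  then have "thick (T \<union> S) f e (u - v)"
    using assms by (intro thick.split[of T f v h S u e g]) (auto simp: thick_between_def)
  then show ?thesis using * by (simp add: thick_between_def Un_commute)
qed

section \<open>Distortion of logarithms of Moebius maps\<close>

definition log_moebius :: "real \<Rightarrow> real \<Rightarrow> real \<Rightarrow> real \<Rightarrow> real \<Rightarrow> real" where
  "log_moebius \<alpha> \<beta> \<gamma> \<delta> z = ln (\<alpha> + \<beta> * z) - ln (\<gamma> + \<delta> * z)"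

lemma affine_pos: "0 \<le> \<alpha> \<Longrightarrow> 0 \<le> \<beta> \<Longrightarrow> 0 < \<alpha> + \<beta> \<Longrightarrow> 0 < z \<Longrightarrow> 0 < \<alpha> + \<beta> * (z::real)"
  by (metis add_cancel_left_left add_nonneg_pos add_pos_nonneg linorder_not_le mult_eq_0_iff
      mult_nonneg_nonneg nless_le)

lemma log_moebius_deriv:
  assumes "0 \<le> \<alpha>" "0 \<le> \<beta>" "0 < \<alpha> + \<beta>" "0 \<le> \<gamma>" "0 \<le> \<delta>" "0 < \<gamma> + \<delta>" "0 < z"
  shows "(log_moebius \<alpha> \<beta> \<gamma> \<delta> has_real_derivative
     (\<beta> * \<gamma> - \<alpha> * \<delta>) / ((\<alpha> + \<beta> * z) * (\<gamma> + \<delta> * z))) (at z)"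
proof -
  have p: "0 < \<alpha> + \<beta> * z" "0 < \<gamma> + \<delta> * z" using assms affine_pos by auto
  have "((\<lambda>z. ln (\<alpha> + \<beta> * z) - ln (\<gamma> + \<delta> * z)) has_real_derivative
     (\<beta> / (\<alpha> + \<beta> * z) - \<delta> / (\<gamma> + \<delta> * z))) (at z)"
    using p by (auto intro!: derivative_eq_intros simp: divide_simps)
  moreover have "\<beta> / (\<alpha> + \<beta> * z) - \<delta> / (\<gamma> + \<delta> * z) =
      (\<beta> * \<gamma> - \<alpha> * \<delta>) / ((\<alpha> + \<beta> * z) * (\<gamma> + \<delta> * z))"
    using p by (simp add: divide_simps) (simp add: algebra_simps)
  ultimately show ?thesis by (simp add: log_moebius_def[abs_def])
qed

lemma log_moebius_mvt:
  assumes "0 \<le> \<alpha>" "0 \<le> \<beta>" "0 < \<alpha> + \<beta>" "0 \<le> \<gamma>" "0 \<le> \<delta>" "0 < \<gamma> + \<delta>" "0 < p" "p \<le> q"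
  obtains z where "p \<le> z" "z \<le> q" "log_moebius \<alpha> \<beta> \<gamma> \<delta> q - log_moebius \<alpha> \<beta> \<gamma> \<delta> p =
     (q - p) * ((\<beta> * \<gamma> - \<alpha> * \<delta>) / ((\<alpha> + \<beta> * z) * (\<gamma> + \<delta> * z)))"
proof (cases "p = q")
  case True
  then show ?thesis using that[of p] by simp
next
  case False
  then have "p < q" using assms by simp
  from MVT2[OF this, of "log_moebius \<alpha> \<beta> \<gamma> \<delta>"
      "\<lambda>z. (\<beta> * \<gamma> - \<alpha> * \<delta>) / ((\<alpha> + \<beta> * z) * (\<gamma> + \<delta> * z))"]
  show ?thesis using that assms log_moebius_deriv by (smt (verit, ccfv_SIG))
qed

lemma log_moebius_monotone:
  assumes "0 \<le> \<alpha>" "0 \<le> \<beta>" "0 < \<alpha> + \<beta>" "0 \<le> \<gamma>" "0 \<le> \<delta>" "0 < \<gamma> + \<delta>"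
  shows "(\<forall>p q. 0 < p \<and> p \<le> q \<longrightarrow> log_moebius \<alpha> \<beta> \<gamma> \<delta> p \<le> log_moebius \<alpha> \<beta> \<gamma> \<delta> q) \<or>
    (\<forall>p q. 0 < p \<and> p \<le> q \<longrightarrow> log_moebius \<alpha> \<beta> \<gamma> \<delta> q \<le> log_moebius \<alpha> \<beta> \<gamma> \<delta> p)"
proof -
  have "0 \<le> (\<beta> * \<gamma> - \<alpha> * \<delta>) * (log_moebius \<alpha> \<beta> \<gamma> \<delta> q - log_moebius \<alpha> \<beta> \<gamma> \<delta> p)"
    if "0 < p" "p \<le> q" for p q
  proof -
    obtain z where z: "p \<le> z" "z \<le> q" "log_moebius \<alpha> \<beta> \<gamma> \<delta> q - log_moebius \<alpha> \<beta> \<gamma> \<delta> p =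
     (q - p) * ((\<beta> * \<gamma> - \<alpha> * \<delta>) / ((\<alpha> + \<beta> * z) * (\<gamma> + \<delta> * z)))"
      using log_moebius_mvt[OF assms \<open>0 < p\<close> \<open>p \<le> q\<close>] by blast
    have pos: "0 < \<alpha> + \<beta> * z" "0 < \<gamma> + \<delta> * z" using assms affine_pos z that by auto
    have "(\<beta> * \<gamma> - \<alpha> * \<delta>) * (log_moebius \<alpha> \<beta> \<gamma> \<delta> q - log_moebius \<alpha> \<beta> \<gamma> \<delta> p) =
       (q - p) * ((\<beta> * \<gamma> - \<alpha> * \<delta>)\<^sup>2 / ((\<alpha> + \<beta> * z) * (\<gamma> + \<delta> * z)))"
      unfolding z(3) by (simp add: power2_eq_square)
    then show ?thesis using pos that by simp
  qed
  then show ?thesis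
    by (smt (verit) log_moebius_mvt[OF assms] mult_eq_0_iff zero_le_mult_iff divide_eq_0_iff)
qed

text \<open>
  The derivative is a constant divided by \<open>(\<alpha> + \<beta> z) (\<gamma> + \<delta> z)\<close>, whose absolute value does not
  increase with \<open>z\<close>. So a higher interval that is no longer has no longer image.\<close>

lemma log_moebius_contracts_upwards:
  assumes "0 \<le> \<alpha>" "0 \<le> \<beta>" "0 < \<alpha> + \<beta>" "0 \<le> \<gamma>" "0 \<le> \<delta>" "0 < \<gamma> + \<delta>"
    and "0 < p" "p \<le> q" "q \<le> r" "r \<le> s" "s - r \<le> q - p"
  shows "\<bar>log_moebius \<alpha> \<beta> \<gamma> \<delta> s - log_moebius \<alpha> \<beta> \<gamma> \<delta> r\<bar> \<le>
    \<bar>log_moebius \<alpha> \<beta> \<gamma> \<delta> q - log_moebius \<alpha> \<beta> \<gamma> \<delta> p\<bar>"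
proof -
  obtain x where x: "p \<le> x" "x \<le> q" "log_moebius \<alpha> \<beta> \<gamma> \<delta> q - log_moebius \<alpha> \<beta> \<gamma> \<delta> p =
     (q - p) * ((\<beta> * \<gamma> - \<alpha> * \<delta>) / ((\<alpha> + \<beta> * x) * (\<gamma> + \<delta> * x)))"
    using log_moebius_mvt[OF assms(1-8)] by blast
  have "0 < r" using assms by simp
  obtain y where y: "r \<le> y" "y \<le> s" "log_moebius \<alpha> \<beta> \<gamma> \<delta> s - log_moebius \<alpha> \<beta> \<gamma> \<delta> r =
     (s - r) * ((\<beta> * \<gamma> - \<alpha> * \<delta>) / ((\<alpha> + \<beta> * y) * (\<gamma> + \<delta> * y)))"
    using log_moebius_mvt[OF assms(1-6) \<open>0 < r\<close> \<open>r \<le> s\<close>] by blast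
  have xy: "x \<le> y" "0 < x" using x y assms by auto
  have px: "0 < \<alpha> + \<beta> * x" "0 < \<gamma> + \<delta> * x" using assms affine_pos xy by auto
  have le: "\<alpha> + \<beta> * x \<le> \<alpha> + \<beta> * y" "\<gamma> + \<delta> * x \<le> \<gamma> + \<delta> * y"
    using assms xy by (auto intro: mult_left_mono)
  have "\<bar>log_moebius \<alpha> \<beta> \<gamma> \<delta> s - log_moebius \<alpha> \<beta> \<gamma> \<delta> r\<bar> =
      (s - r) * (\<bar>\<beta> * \<gamma> - \<alpha> * \<delta>\<bar> / ((\<alpha> + \<beta> * y) * (\<gamma> + \<delta> * y)))"
    unfolding y(3) using px le assms by (simp add: abs_mult)
  also have "\<dots> \<le> (q - p) * (\<bar>\<beta> * \<gamma> - \<alpha> * \<delta>\<bar> / ((\<alpha> + \<beta> * x) * (\<gamma> + \<delta> * x)))"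
    using px le assms by (intro mult_mono divide_left_mono) auto
  also have "\<dots> = \<bar>log_moebius \<alpha> \<beta> \<gamma> \<delta> q - log_moebius \<alpha> \<beta> \<gamma> \<delta> p\<bar>"
    unfolding x(3) using px assms by (simp add: abs_mult)
  finally show ?thesis .
qed

text \<open>
  In the coordinate \<open>w = 1/(1+z)\<close> numerator and denominator become \<open>(\<beta> + (\<alpha> - \<beta>) w)/w\<close> and
  \<open>(\<delta> + (\<gamma> - \<delta>) w)/w\<close>. The factors \<open>1/w\<close> cancel and the new coefficients are again nonnegative.\<close>

lemma log_moebius_reparam:
  assumes "0 \<le> \<beta>" "\<beta> \<le> \<alpha>" "0 < \<alpha>" "0 \<le> \<delta>" "\<delta> \<le> \<gamma>" "0 < \<gamma>" "0 < z"
  shows "log_moebius \<alpha> \<beta> \<gamma> \<delta> z = log_moebius \<beta> (\<alpha> - \<beta>) \<delta> (\<gamma> - \<delta>) (1 / (1 + z))"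
proof -
  have *: "ln (\<alpha> + \<beta> * z) = ln (\<beta> + (\<alpha> - \<beta>) * (1 / (1 + z))) + ln (1 + z)"
    if "0 \<le> \<beta>" "\<beta> \<le> \<alpha>" "0 < \<alpha>" for \<alpha> \<beta>
  proof -
    have "0 < \<alpha> + \<beta> * z" using that assms by (simp add: add_pos_nonneg)
    moreover have "\<beta> + (\<alpha> - \<beta>) * (1 / (1 + z)) = (\<alpha> + \<beta> * z) / (1 + z)"
      using assms by (simp add: field_simps)
    ultimately show ?thesis using assms by (simp add: ln_div)
  qed
  show ?thesis unfolding log_moebius_def using *[of \<beta> \<alpha>] *[of \<delta> \<gamma>] assms by simp
qed

text \<open>
  This is the previous comparison in the coordinate \<open>1/(1+z)\<close>, which reverses the order. It is sharp
  enough for all levels because \<open>\<beta> \<le> \<alpha>\<close> and \<open>\<delta> \<le> \<gamma>\<close> hold for every composition of maps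
  \<open>z \<mapsto> 1/(k+z)\<close> with \<open>k \<ge> 1\<close>.\<close>

lemma log_moebius_expands_upwards:
  assumes "0 \<le> \<beta>" "\<beta> \<le> \<alpha>" "0 < \<alpha>" "0 \<le> \<delta>" "\<delta> \<le> \<gamma>" "0 < \<gamma>"
    and "0 < p" "p \<le> q" "q \<le> r" "r \<le> s"
    and "1 / (1 + p) - 1 / (1 + q) \<le> 1 / (1 + r) - 1 / (1 + s)"
  shows "\<bar>log_moebius \<alpha> \<beta> \<gamma> \<delta> q - log_moebius \<alpha> \<beta> \<gamma> \<delta> p\<bar> \<le>
    \<bar>log_moebius \<alpha> \<beta> \<gamma> \<delta> s - log_moebius \<alpha> \<beta> \<gamma> \<delta> r\<bar>"
proof -
  let ?L = "log_moebius \<beta> (\<alpha> - \<beta>) \<delta> (\<gamma> - \<delta>)"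
  have "\<bar>?L (1 / (1 + p)) - ?L (1 / (1 + q))\<bar> \<le> \<bar>?L (1 / (1 + r)) - ?L (1 / (1 + s))\<bar>"
    using assms by (intro log_moebius_contracts_upwards) (auto intro: divide_left_mono)
  then show ?thesis
    using assms by (simp add: log_moebius_reparam abs_minus_commute)
qed

text \<open>
  Prefixing a digit \<open>k\<close> stays within the same family of functions, so that one induction covers all
  cylinders of the Cantor set.\<close>

lemma log_moebius_inverse_shift:
  assumes "0 \<le> \<beta>" "0 < \<alpha>" "0 \<le> \<delta>" "0 < \<gamma>" "0 < k + z" "0 \<le> z" "0 \<le> k"
  shows "log_moebius \<alpha> \<beta> \<gamma> \<delta> (1 / (k + z)) = log_moebius (\<alpha> * k + \<beta>) \<alpha> (\<gamma> * k + \<delta>) \<gamma> z"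
proof -
  have *: "ln (\<alpha> + \<beta> * (1 / (k + z))) = ln (\<alpha> * k + \<beta> + \<alpha> * z) - ln (k + z)"
    if "0 \<le> \<beta>" "0 < \<alpha>" for \<alpha> \<beta>
  proof -
    have "0 < \<alpha> * (k + z) + \<beta>" using that assms by (simp add: add_pos_nonneg)
    moreover have "\<alpha> + \<beta> * (1 / (k + z)) = (\<alpha> * (k + z) + \<beta>) / (k + z)"
      using assms by (simp add: field_simps)
    ultimately show ?thesis using assms by (simp add: ln_div algebra_simps)
  qed
  show ?thesis unfolding log_moebius_def using *[of \<beta> \<alpha>] *[of \<delta> \<gamma>] assms by simp
qed


section \<open>The gaps of F(4)\<close>

text \<open>
  The least element of \<open>F(4)\<close>, namely \<open>[0; 4, 1, 4, 1, \<dots>]\<close>; the greatest, \<open>[0; 1, 4, 1, 4, \<dots>]\<close>,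
  is \<open>4 mu\<close>.\<close>

definition mu :: real where
  "mu = (sqrt 2 - 1) / 2"

lemma mu_bounds: "2071/10000 < mu" "mu < 20711/100000"
proof -
  have "1.4142 < sqrt 2" by (rule real_less_rsqrt) (simp add: power2_eq_square)
  moreover have "sqrt 2 < 1.41422" by (rule real_less_lsqrt) (simp_all add: power2_eq_square)
  ultimately show "2071/10000 < mu" "mu < 20711/100000" by (simp_all add: mu_def)
qed

lemma mu_quadratic: "4 * mu\<^sup>2 + 4 * mu = 1"
proof -
  have "4 * mu\<^sup>2 + 4 * mu = (2 * mu + 1)\<^sup>2 - 1" by (simp add: power2_eq_square algebra_simps)
  also have "2 * mu + 1 = sqrt 2" by (simp add: mu_def field_simps)
  finally show ?thesis by simp
qed

lemma mu_fixed: "1 / (1 + mu) = 4 * mu" "1 / (4 + 4 * mu) = mu"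
proof -
  have "4 * mu * (1 + mu) = 1" using mu_quadratic by (simp add: power2_eq_square algebra_simps)
  then show "1 / (1 + mu) = 4 * mu" "1 / (4 + 4 * mu) = mu"
    using mu_bounds by (simp_all add: field_simps)
qed

text \<open>
  The gap between the numbers in \<open>F(4)\<close> with first digit above \<open>k\<close> and those with first digit \<open>k\<close>.\<close>

definition gap_lower :: "nat \<Rightarrow> real" where "gap_lower k = 1 / (real k + 1 + mu)"
definition gap_upper :: "nat \<Rightarrow> real" where "gap_upper k = 1 / (real k + 4 * mu)"

lemma recip_ge: "0 < x \<Longrightarrow> x \<le> b \<Longrightarrow> c * b \<le> 1 \<Longrightarrow> 0 \<le> c \<Longrightarrow> c \<le> 1 / (x::real)"
  using mult_left_mono[of x b c] by (simp add: field_simps)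

lemma recip_le: "0 < a \<Longrightarrow> a \<le> x \<Longrightarrow> 1 \<le> d * a \<Longrightarrow> 0 \<le> d \<Longrightarrow> 1 / (x::real) \<le> d"
  using mult_left_mono[of a x d] by (simp add: field_simps)

lemma gap_numeric:
  "0.4530 \<le> gap_lower 1" "gap_lower 1 \<le> 0.4531"
  "0.5469 \<le> gap_upper 1" "gap_upper 1 \<le> 0.5470"
  "0.3118 \<le> gap_lower 2" "gap_lower 2 \<le> 0.3119"
  "0.3535 \<le> gap_upper 2" "gap_upper 2 \<le> 0.3536"
  "0.2376 \<le> gap_lower 3" "gap_lower 3 \<le> 0.2377"
  "0.2611 \<le> gap_upper 3" "gap_upper 3 \<le> 0.2613"
  unfolding gap_lower_def gap_upper_def
  subgoal by (rule recip_ge[of _ "2.20711"]; use mu_bounds in simp)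
  subgoal by (rule recip_le[of "2.2071"]; use mu_bounds in simp)
  subgoal by (rule recip_ge[of _ "1.82844"]; use mu_bounds in simp)
  subgoal by (rule recip_le[of "1.8284"]; use mu_bounds in simp)
  subgoal by (rule recip_ge[of _ "3.20711"]; use mu_bounds in simp)
  subgoal by (rule recip_le[of "3.2071"]; use mu_bounds in simp)
  subgoal by (rule recip_ge[of _ "2.82844"]; use mu_bounds in simp)
  subgoal by (rule recip_le[of "2.8284"]; use mu_bounds in simp)
  subgoal by (rule recip_ge[of _ "4.20711"]; use mu_bounds in simp)
  subgoal by (rule recip_le[of "4.2071"]; use mu_bounds in simp)
  subgoal by (rule recip_ge[of _ "3.82844"]; use mu_bounds in simp)
  subgoal by (rule recip_le[of "3.8284"]; use mu_bounds in simp)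
  done

lemma recip_diff:
  assumes "0 < x" "0 < (y::real)"
  shows "1 / x - 1 / y = (y - x) / (x * y)"
  using assms by (simp add: field_simps)

lemma recip_diff_bounds:
  assumes "x0 \<le> x" "x \<le> y" "0 < (x0::real)" "0 < x1" "x1 \<le> y" "y - x \<le> c * (x0 * x1)" "0 \<le> c"
  shows "1 / x - 1 / y \<le> c"
proof -
  have "y - x \<le> c * (x * y)"
    using assms mult_left_mono[OF mult_mono[OF assms(1,5)], of c] by linarith
  then show ?thesis using assms by (simp add: recip_diff field_simps)
qed

lemma recip_diff_bounds':
  assumes "0 < (x::real)" "x \<le> y" "x \<le> x0" "y \<le> x1" "c * (x0 * x1) \<le> y - x" "0 \<le> c"
  shows "c \<le> 1 / x - 1 / y"
proof -
  have "c * (x * y) \<le> y - x"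
    using assms mult_left_mono[OF mult_mono[OF assms(3,4)], of c] by linarith
  then show ?thesis using assms by (simp add: recip_diff field_simps)
qed

lemma gap_order:
  assumes "k \<in> {1..3}"
  shows "mu < gap_lower k" "gap_lower k < gap_upper k" "gap_upper k < 1 / (real k + mu)"
proof -
  have "k = 1 \<or> k = 2 \<or> k = 3" using assms by auto
  then show "mu < gap_lower k" "gap_lower k < gap_upper k"
    using gap_numeric mu_bounds by auto
  show "gap_upper k < 1 / (real k + mu)"
    unfolding gap_upper_def using assms mu_bounds by (intro divide_strict_left_mono) auto
qed

text \<open>
  The next five lemmas are the numerical content of the thickness of \<open>F(4)\<close>. Pieces below a gap, and
  child gaps above it, are compared in ordinary length; pieces above a gap, and child gaps below it, in
  the coordinate \<open>1/(1+z)\<close>. Each time this is the coordinate in which the comparison survives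
  \<open>log_moebius\<close>.\<close>

lemma gap_le_left:
  assumes "k \<in> {1..3}"
  shows "gap_upper k - gap_lower k \<le> gap_lower k - mu"
proof -
  have "k = 1 \<or> k = 2 \<or> k = 3" using assms by auto
  then show ?thesis using gap_numeric mu_bounds by auto
qed

lemma gap_le_right:
  assumes "k \<in> {1..3}"
  shows "1 / (1 + gap_lower k) - 1 / (1 + gap_upper k)
    \<le> 1 / (1 + gap_upper k) - 1 / (1 + 1 / (real k + mu))"
proof -
  have k: "real k = 1 \<or> real k = 2 \<or> real k = 3" using assms by auto
  have 1: "1 / (1 + gap_lower k) = 1 - 1 / (real k + 2 + mu)"
    "1 / (1 + gap_upper k) = 1 - 1 / (real k + 1 + 4 * mu)"
    "1 / (1 + 1 / (real k + mu)) = 1 - 1 / (real k + 1 + mu)"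
    unfolding gap_lower_def gap_upper_def using mu_bounds by (simp_all add: field_simps)
  have 2: "1 / (real k + 1 + 4 * mu) - 1 / (real k + 2 + mu)
    \<le> (1 - 3 * mu) / ((real k + 1 + 4 * mu) * (real k + 2 + mu))"
    using mu_bounds by (subst recip_diff) auto
  have 3: "1 / (real k + 1 + mu) - 1 / (real k + 1 + 4 * mu) =
     (3 * mu) / ((real k + 1 + mu) * (real k + 1 + 4 * mu))"
    using mu_bounds by (subst recip_diff) auto
  have "(1 - 3 * mu) / ((real k + 1 + 4 * mu) * (real k + 2 + mu))
     \<le> (3 * mu) / ((real k + 1 + mu) * (real k + 1 + 4 * mu))"
    using mu_bounds by (intro frac_le mult_mono) (auto simp: mult.commute[of "real k + 1 + 4 * mu"] intro!: mult_right_mono)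
  then show ?thesis unfolding 1 using 2 3 by linarith
qed

text \<open>
  The child gap here is the widest gap, between first digits 2 and 1, carried into the cylinder of
  digit \<open>k\<close> by \<open>z \<mapsto> 1/(k+z)\<close>.\<close>

lemma child_gap_right:
  assumes "k \<in> {1..3}"
  shows "1 / (real k + gap_lower 1) - 1 / (real k + gap_upper 1) \<le> gap_upper k - gap_lower k"
proof -
  have "k = 1 \<or> k = 2 \<or> k = 3" using assms by auto
  moreover have "1 / (1 + gap_lower 1) - 1 / (1 + gap_upper 1) \<le> 1/20"
    by (rule recip_diff_bounds[of "1.4530" _ _ "1.5469"]; use gap_numeric in simp)
  moreover have "1 / (2 + gap_lower 1) - 1 / (2 + gap_upper 1) \<le> 1/50"
    by (rule recip_diff_bounds[of "2.4530" _ _ "2.5469"]; use gap_numeric in simp)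
  moreover have "1 / (3 + gap_lower 1) - 1 / (3 + gap_upper 1) \<le> 1/100"
    by (rule recip_diff_bounds[of "3.4530" _ _ "3.5469"]; use gap_numeric in simp)
  ultimately show ?thesis using gap_numeric by auto
qed

lemma child_gap_left:
  assumes "k \<in> {1..2}"
  shows "1 / (1 + gap_lower (Suc k)) - 1 / (1 + gap_upper (Suc k))
    \<le> 1 / (1 + gap_lower k) - 1 / (1 + gap_upper k)"
proof -
  have A: "1 / (1 + gap_lower 2) - 1 / (1 + gap_upper 2) \<le> 1/40"
    by (rule recip_diff_bounds[of "1.3118" _ _ "1.3535"]; use gap_numeric in simp)
  have B: "1/25 \<le> 1 / (1 + gap_lower 1) - 1 / (1 + gap_upper 1)"
    by (rule recip_diff_bounds'[where ?x0.0="1.4531" and ?x1.0="1.5470"]; use gap_numeric in simp)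
  have C: "1 / (1 + gap_lower 3) - 1 / (1 + gap_upper 3) \<le> 2/125"
    by (rule recip_diff_bounds[of "1.2376" _ _ "1.2611"]; use gap_numeric in simp)
  have D: "11/500 \<le> 1 / (1 + gap_lower 2) - 1 / (1 + gap_upper 2)"
    by (rule recip_diff_bounds'[where ?x0.0="1.3119" and ?x1.0="1.3536"]; use gap_numeric in simp)
  from assms consider "k = 1" "Suc k = 2" | "k = 2" "Suc k = 3" by fastforce
  then show ?thesis
  proof cases
    case 1
    show ?thesis unfolding 1(2) unfolding 1(1) using A B by linarith
  next
    case 2
    show ?thesis unfolding 2(2) unfolding 2(1) using C D by linarith
  qed
qed

text \<open>
  Below the gap for \<open>k = 3\<close> only the cylinder of digit 4 is left, and its first gap comes from one level
  deeper.\<close>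

lemma child_gap_left_last:
  "1 / (1 + 1 / (4 + gap_upper 1)) - 1 / (1 + 1 / (4 + gap_lower 1))
    \<le> 1 / (1 + gap_lower 3) - 1 / (1 + gap_upper 3)"
proof -
  have "1 / (1 + 1 / (4 + gap_upper 1)) - 1 / (1 + 1 / (4 + gap_lower 1)) =
     1 / (5 + gap_lower 1) - 1 / (5 + gap_upper 1)"
    using gap_numeric by (simp add: field_simps)
  moreover have "1 / (5 + gap_lower 1) - 1 / (5 + gap_upper 1) \<le> 1/100"
    by (rule recip_diff_bounds[of "5.4530" _ _ "5.5469"]; use gap_numeric in simp)
  moreover have "3/250 \<le> 1 / (1 + gap_lower 3) - 1 / (1 + gap_upper 3)"
    by (rule recip_diff_bounds'[where ?x0.0="1.2377" and ?x1.0="1.2613"]; use gap_numeric in simp)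
  ultimately show ?thesis by linarith
qed


section \<open>Thickness of the approximations of F(4)\<close>

text \<open>
  \<open>cf4 n 1\<close> is the \<open>n\<close>-th approximation of \<open>F(4)\<close>: the numbers \<open>[0; a\<^sub>1, \<dots>, a\<^sub>n + z]\<close> with digits
  in \<open>{1..4}\<close> and \<open>mu \<le> z \<le> 4 mu\<close>. The parameter \<open>k\<close> bounds the first digit from below: the digits are
  split off one at a time, 1 first, so that each step removes a single gap. At level 0 only the hull is
  left, which has no gap.\<close>

primrec cf4 :: "nat \<Rightarrow> nat \<Rightarrow> real set" where
  "cf4 0 k = {mu..1 / (real k + mu)}"
| "cf4 (Suc n) k = (\<Union>a\<in>{k..4}. (\<lambda>z. 1 / (real a + z)) ` cf4 n 1)"

lemma cf4_bounds: "cf4 n 1 \<subseteq> {mu..4 * mu}"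
proof (induction n)
  case 0
  then show ?case using mu_fixed by simp
next
  case (Suc n)
  have "1 / (real a + z) \<in> {mu..4 * mu}" if a: "a \<in> {1..4}" and z: "z \<in> cf4 n 1" for a z
  proof -
    have z': "mu \<le> z" "z \<le> 4 * mu" using Suc z by auto
    have "1 / (4 + 4 * mu) \<le> 1 / (real a + z)" "1 / (real a + z) \<le> 1 / (1 + mu)"
      using z' a mu_bounds by (auto intro!: divide_left_mono mult_pos_pos)
    then show ?thesis using mu_fixed by simp
  qed
  then show ?case by auto
qed

lemma continuous_on_log_moebius:
  assumes "0 \<le> \<alpha>" "0 \<le> \<beta>" "0 < \<alpha> + \<beta>" "0 \<le> \<gamma>" "0 \<le> \<delta>" "0 < \<gamma> + \<delta>" "A \<subseteq> {0<..}"
  shows "continuous_on A (log_moebius \<alpha> \<beta> \<gamma> \<delta>)"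
  by (intro continuous_at_imp_continuous_on ballI DERIV_isCont[OF log_moebius_deriv])
     (use assms in auto)

definition cf4_gap :: "(real \<Rightarrow> real) \<Rightarrow> nat \<Rightarrow> nat \<Rightarrow> real" where
  "cf4_gap f n k = (if n = 0 then 0 else \<bar>f (gap_upper k) - f (gap_lower k)\<bar>)"

text \<open>
  Splitting off the digit \<open>k\<close>: \<open>left\<close> is the part with larger first digits, \<open>right\<close> the cylinder of
  \<open>k\<close>.\<close>

lemma thick_cf4_step:
  fixes \<alpha> \<beta> \<gamma> \<delta> :: real
  defines "L \<equiv> log_moebius \<alpha> \<beta> \<gamma> \<delta>"
  assumes coeff: "0 \<le> \<beta>" "\<beta> \<le> \<alpha>" "0 < \<alpha>" "0 \<le> \<delta>" "\<delta> \<le> \<gamma>" "0 < \<gamma>" and k: "k \<in> {1..3}"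
    and left: "thick_between (L ` cf4 (Suc n) (Suc k)) (L mu) (L (gap_lower k)) g"
      "g \<le> \<bar>L (gap_upper k) - L (gap_lower k)\<bar>"
    and right: "thick_between (L ` (\<lambda>z. 1 / (real k + z)) ` cf4 n 1)
        (L (gap_upper k)) (L (1 / (real k + mu))) h"
      "h \<le> \<bar>L (1 / (real k + gap_upper 1)) - L (1 / (real k + gap_lower 1))\<bar>"
  shows "thick_between (L ` cf4 (Suc n) k) (L mu) (L (1 / (real k + mu)))
    \<bar>L (gap_upper k) - L (gap_lower k)\<bar>"
proof -
  note order = gap_order[OF k]
  have mu0: "0 < mu" using mu_bounds by simp
  have union: "cf4 (Suc n) k = cf4 (Suc n) (Suc k) \<union> (\<lambda>z. 1 / (real k + z)) ` cf4 n 1"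
  proof -
    have "{k..4} = insert k {Suc k..4}" using k by auto
    then show ?thesis by auto
  qed
  have mono: "(L mu \<le> L (gap_lower k) \<and> L (gap_lower k) \<le> L (gap_upper k) \<and>
      L (gap_upper k) \<le> L (1 / (real k + mu))) \<or>
    (L (1 / (real k + mu)) \<le> L (gap_upper k) \<and> L (gap_upper k) \<le> L (gap_lower k) \<and>
      L (gap_lower k) \<le> L mu)"
    using log_moebius_monotone[of \<alpha> \<beta> \<gamma> \<delta>] coeff order mu0 unfolding L_def
    by (smt (verit))
  have gap_left: "\<bar>L (gap_upper k) - L (gap_lower k)\<bar> \<le> \<bar>L (gap_lower k) - L mu\<bar>"
    unfolding L_def using coeff order mu0 gap_le_left[OF k]
    by (intro log_moebius_contracts_upwards) auto
  have gap_right: "\<bar>L (gap_upper k) - L (gap_lower k)\<bar> \<le> \<bar>L (1 / (real k + mu)) - L (gap_upper k)\<bar>"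
    unfolding L_def using coeff order mu0 gap_le_right[OF k]
    by (intro log_moebius_expands_upwards) auto
  have gu1: "0 < gap_lower 1" "gap_lower 1 < gap_upper 1" "gap_upper 1 \<le> 4 * mu"
    using gap_numeric mu_bounds by auto
  have "\<bar>L (1 / (real k + gap_lower 1)) - L (1 / (real k + gap_upper 1))\<bar>
      \<le> \<bar>L (gap_upper k) - L (gap_lower k)\<bar>"
    unfolding L_def
  proof (rule log_moebius_contracts_upwards)
    show "gap_upper k \<le> 1 / (real k + gap_upper 1)"
      unfolding gap_upper_def[of k] using gu1 k by (intro divide_left_mono) auto
    show "1 / (real k + gap_upper 1) \<le> 1 / (real k + gap_lower 1)"
      using gu1 k by (intro divide_left_mono) auto
  qed (use coeff order mu0 child_gap_right[OF k] in auto)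
  then have "h \<le> \<bar>L (gap_upper k) - L (gap_lower k)\<bar>" using right(2) by simp
  from thick_between_split[OF left(1) right(1) mono left(2) this gap_left gap_right]
  show ?thesis unfolding union image_Un .
qed

text \<open>
  The logarithm of any composition of digit maps is allowed, because the cylinder of a digit \<open>a\<close> is
  itself an image of the whole set, with the coefficients changed by \<open>log_moebius_inverse_shift\<close>. Within one
  level the digits are added from 4 down to 1.\<close>

lemma thick_cf4:
  assumes "0 \<le> \<beta>" "\<beta> \<le> \<alpha>" "0 < \<alpha>" "0 \<le> \<delta>" "\<delta> \<le> \<gamma>" "0 < \<gamma>" "k \<in> {1..3}"
  shows "thick_between (log_moebius \<alpha> \<beta> \<gamma> \<delta> ` cf4 n k) (log_moebius \<alpha> \<beta> \<gamma> \<delta> mu)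
    (log_moebius \<alpha> \<beta> \<gamma> \<delta> (1 / (real k + mu))) (cf4_gap (log_moebius \<alpha> \<beta> \<gamma> \<delta>) n k)"
  using assms
proof (induction n arbitrary: \<alpha> \<beta> \<gamma> \<delta> k)
  case (0 \<alpha> \<beta> \<gamma> \<delta> k)
  let ?L = "log_moebius \<alpha> \<beta> \<gamma> \<delta>" and ?I = "{mu..1 / (real k + mu)}"
  have le: "mu \<le> 1 / (real k + mu)" using gap_order[OF 0(7)] by linarith
  have "continuous_on ?I ?L"
    using 0 mu_bounds by (intro continuous_on_log_moebius) auto
  then have "connected (?L ` ?I)" by (intro connected_continuous_image) auto
  moreover have "min (?L mu) (?L (1 / (real k + mu))) \<in> ?L ` ?I"
    "max (?L mu) (?L (1 / (real k + mu))) \<in> ?L ` ?I"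
    using le by (auto simp: min_def max_def)
  ultimately show ?case
    unfolding thick_between_def cf4_gap_def
    by (auto intro!: thick.base dest: connected_contains_Icc)
next
  case (Suc n \<alpha> \<beta> \<gamma> \<delta> k)
  note coeff = Suc.prems(1-6)
  define L where "L = log_moebius \<alpha> \<beta> \<gamma> \<delta>"
  define piece where "piece a = L ` (\<lambda>z. 1 / (real a + z)) ` cf4 n 1" for a :: nat
  have mu0: "0 < mu" using mu_bounds by simp
  have gu1: "0 < gap_lower 1" "0 < gap_upper 1"
    using gap_numeric by auto
  have piece: "\<exists>h. thick_between (piece a) (L (1 / (real a + 4 * mu))) (L (1 / (real a + mu))) h \<and>
      h \<le> \<bar>L (1 / (real a + gap_upper 1)) - L (1 / (real a + gap_lower 1))\<bar>"
    if a: "a \<in> {1..4}" for a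
  proof -
    let ?La = "log_moebius (\<alpha> * real a + \<beta>) \<alpha> (\<gamma> * real a + \<delta>) \<gamma>"
    have shift: "L (1 / (real a + z)) = ?La z" if "0 \<le> z" for z
      unfolding L_def using coeff a that by (intro log_moebius_inverse_shift) auto
    have "?La ` cf4 n 1 = piece a"
      unfolding piece_def image_image using cf4_bounds[of n] mu0
      by (intro image_cong refl shift[symmetric]) auto
    moreover have "thick_between (?La ` cf4 n 1) (?La mu) (?La (1 / (real 1 + mu))) (cf4_gap ?La n 1)"
      using coeff a by (intro Suc.IH) (auto intro!: add_pos_nonneg mult_pos_pos simp: add_increasing2 mult_le_cancel_left1)
    ultimately have "thick_between (piece a) (L (1 / (real a + 4 * mu))) (L (1 / (real a + mu)))
       (cf4_gap ?La n 1)"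
      using mu_fixed mu0 by (simp add: shift thick_between_commute)
    moreover have "cf4_gap ?La n 1 \<le> \<bar>L (1 / (real a + gap_upper 1)) - L (1 / (real a + gap_lower 1))\<bar>"
      using gu1 by (simp add: shift cf4_gap_def)
    ultimately show ?thesis by blast
  qed
  have step: "thick_between (L ` cf4 (Suc n) k) (L mu) (L (1 / (real k + mu)))
      \<bar>L (gap_upper k) - L (gap_lower k)\<bar>"
    if k: "k \<in> {1..3}"
      and "thick_between (L ` cf4 (Suc n) (Suc k)) (L mu) (L (gap_lower k)) g"
        "g \<le> \<bar>L (gap_upper k) - L (gap_lower k)\<bar>" for k g
  proof -
    obtain h where "thick_between (piece k) (L (1 / (real k + 4 * mu))) (L (1 / (real k + mu))) h"
      "h \<le> \<bar>L (1 / (real k + gap_upper 1)) - L (1 / (real k + gap_lower 1))\<bar>"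
      using piece[of k] k by auto
    then show ?thesis
      using thick_cf4_step[OF coeff k, of n g h] that unfolding L_def piece_def gap_upper_def[of k]
      by blast
  qed
  have 3: "thick_between (L ` cf4 (Suc n) 3) (L mu) (L (1 / (real 3 + mu)))
      \<bar>L (gap_upper 3) - L (gap_lower 3)\<bar>"
  proof -
    obtain h where h: "thick_between (piece 4) (L (1 / (real 4 + 4 * mu))) (L (1 / (real 4 + mu))) h"
      "h \<le> \<bar>L (1 / (real 4 + gap_upper 1)) - L (1 / (real 4 + gap_lower 1))\<bar>"
      using piece[of 4] by auto
    have "piece 4 = L ` cf4 (Suc n) (Suc 3)" by (auto simp: piece_def)
    then have "thick_between (L ` cf4 (Suc n) (Suc 3)) (L mu) (L (gap_lower 3)) h"
      using h(1) mu_fixed by (simp add: gap_lower_def)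
    moreover have "\<bar>L (1 / (4 + gap_lower 1)) - L (1 / (4 + gap_upper 1))\<bar>
        \<le> \<bar>L (gap_upper 3) - L (gap_lower 3)\<bar>"
      unfolding L_def
    proof (rule log_moebius_expands_upwards)
      show "1 / (4 + gap_upper 1) \<le> 1 / (4 + gap_lower 1)"
        using gap_numeric by (intro divide_left_mono) auto
      show "1 / (4 + gap_lower 1) \<le> gap_lower 3"
        unfolding gap_lower_def[of 3] using gap_numeric mu_bounds by (intro divide_left_mono) auto
    qed (use coeff child_gap_left_last gap_numeric in auto)
    ultimately show ?thesis using h(2) by (intro step[of 3 h]) auto
  qed
  have up: "\<bar>L (gap_upper (Suc k)) - L (gap_lower (Suc k))\<bar> \<le> \<bar>L (gap_upper k) - L (gap_lower k)\<bar>"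
    if k: "k \<in> {1..2}" for k
    unfolding L_def
  proof (rule log_moebius_expands_upwards)
    show "0 < gap_lower (Suc k)" "gap_lower (Suc k) \<le> gap_upper (Suc k)" "gap_lower k \<le> gap_upper k"
      using gap_order[of "Suc k"] gap_order[of k] k mu0 by auto
    show "gap_upper (Suc k) \<le> gap_lower k"
      using gap_order(3)[of "Suc k"] k by (simp add: gap_lower_def add.commute)
  qed (use coeff child_gap_left[OF k] in auto)
  have next_type: "Suc 1 = 2" "Suc 2 = 3"
    "gap_lower 1 = 1 / (real 2 + mu)" "gap_lower 2 = 1 / (real 3 + mu)"
    by (simp_all add: gap_lower_def)
  have "thick_between (L ` cf4 (Suc n) (Suc 2)) (L mu) (L (gap_lower 2))
      \<bar>L (gap_upper (Suc 2)) - L (gap_lower (Suc 2))\<bar>"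
    using 3 by (simp only: next_type)
  then have 2: "thick_between (L ` cf4 (Suc n) 2) (L mu) (L (1 / (real 2 + mu)))
      \<bar>L (gap_upper 2) - L (gap_lower 2)\<bar>"
    by (rule step[OF _ _ up, rotated]) auto
  then have "thick_between (L ` cf4 (Suc n) (Suc 1)) (L mu) (L (gap_lower 1))
      \<bar>L (gap_upper (Suc 1)) - L (gap_lower (Suc 1))\<bar>"
    by (simp only: next_type)
  then have 1: "thick_between (L ` cf4 (Suc n) 1) (L mu) (L (1 / (real 1 + mu)))
      \<bar>L (gap_upper 1) - L (gap_lower 1)\<bar>"
    by (rule step[OF _ _ up, rotated]) auto
  have "k = 1 \<or> k = 2 \<or> k = 3" using Suc.prems by auto
  then show ?case using 1 2 3 unfolding cf4_gap_def L_def by auto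
qed


section \<open>Hall's theorem for products\<close>

text \<open>
  Logarithms turn the product into a sum of two thick sets. Since \<open>a\<close> and \<open>b\<close> differ by at most 1,
  the first gap of each is shorter than the hull of the other.\<close>

lemma cf4_product_truncated:
  fixes a b s :: real
  assumes ab: "5 \<le> a" "5 \<le> b" "\<bar>a - b\<bar> \<le> 1"
    and s: "(a + mu) * (b + mu) \<le> s" "s \<le> (a + 4 * mu) * (b + 4 * mu)"
  shows "\<exists>x\<in>cf4 n 1. \<exists>y\<in>cf4 n 1. (a + x) * (b + y) = s"
proof -
  define L where "L c = log_moebius c 1 1 0" for c
  have L: "L c z = ln (c + z)" for c z by (simp add: L_def log_moebius_def)
  have mu0: "0 < mu" using mu_bounds by simp
  have thick: "thick (L c ` cf4 n 1) (ln (c + mu)) (ln (c + 4 * mu)) (cf4_gap (L c) n 1)"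
    if "5 \<le> c" for c
    using thick_cf4[of 1 c 0 1 1 n] that mu0 mu_fixed
    by (simp add: thick_between_def L[symmetric]) (simp add: L_def L[unfolded L_def])
  have gap: "cf4_gap (L c) n 1 \<le> ln (d + 4 * mu) - ln (d + mu)"
    if "5 \<le> c" "5 \<le> d" "\<bar>c - d\<bar> \<le> 1" for c d
  proof -
    note g = gap_numeric(1-4)
    have A: "(gap_upper 1 - gap_lower 1) * d \<le> 1/10 * d"
      using g that by (intro mult_right_mono) auto
    have B: "gap_upper 1 * mu \<le> 3/5 * (3/10)"
      using g mu_bounds by (intro mult_mono) auto
    have C: "3/5 * c \<le> (3 * mu) * c" using that mu_bounds by (intro mult_right_mono) auto
    have D: "0 \<le> mu * gap_lower 1" using mu0 g by simp
    have "(d + 4 * mu) * (c + gap_lower 1) - (c + gap_upper 1) * (d + mu) =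
        (3 * mu) * c + 4 * (mu * gap_lower 1) - (gap_upper 1 - gap_lower 1) * d - gap_upper 1 * mu"
      by (simp add: algebra_simps)
    moreover have "d \<le> c + 1" using that by linarith
    ultimately have "(c + gap_upper 1) * (d + mu) \<le> (d + 4 * mu) * (c + gap_lower 1)"
      using A B C D \<open>5 \<le> c\<close> by argo
    then have "ln ((c + gap_upper 1) * (d + mu)) \<le> ln ((d + 4 * mu) * (c + gap_lower 1))"
      using that g mu0 by (intro ln_mono) (auto intro!: mult_pos_pos)
    then have "ln (c + gap_upper 1) - ln (c + gap_lower 1) \<le> ln (d + 4 * mu) - ln (d + mu)"
      using that g mu0 by (simp add: ln_mult)
    moreover have "ln (c + gap_lower 1) \<le> ln (c + gap_upper 1)" "ln (d + mu) \<le> ln (d + 4 * mu)"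
      using that g mu0 by auto
    ultimately show ?thesis by (simp add: cf4_gap_def L)
  qed
  have pos: "0 < a + mu" "0 < b + mu" "0 < a + 4 * mu" "0 < b + 4 * mu" using ab mu0 by auto
  have s0: "0 < s" using s(1) mult_pos_pos[OF pos(1,2)] by linarith
  have "ln (a + mu) + ln (b + mu) = ln ((a + mu) * (b + mu))"
    using pos by (simp add: ln_mult)
  also have "\<dots> \<le> ln s" using s s0 mult_pos_pos[OF pos(1,2)] by simp
  finally have low: "ln (a + mu) + ln (b + mu) \<le> ln s" .
  have "ln s \<le> ln ((a + 4 * mu) * (b + 4 * mu))" using s s0 mult_pos_pos[OF pos(3,4)] by simp
  also have "\<dots> = ln (a + 4 * mu) + ln (b + 4 * mu)" using pos by (simp add: ln_mult)
  finally have high: "ln s \<le> ln (a + 4 * mu) + ln (b + 4 * mu)" .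
  have "\<exists>p\<in>L a ` cf4 n 1. \<exists>q\<in>L b ` cf4 n 1. p + q = ln s"
    using thick_sum[OF thick thick gap gap low high] ab by (simp add: abs_minus_commute)
  then obtain x y where xy: "x \<in> cf4 n 1" "y \<in> cf4 n 1" "ln (a + x) + ln (b + y) = ln s"
    by (auto simp: L)
  then have "0 < a + x" "0 < b + y" using cf4_bounds[of n] ab mu0 by force+
  moreover from this have "ln ((a + x) * (b + y)) = ln s" using xy by (simp add: ln_mult)
  ultimately have "(a + x) * (b + y) = s" using s0 by simp
  then show ?thesis using xy by blast
qed

lemma compact_cf4: "compact (cf4 n 1)"
proof (induction n)
  case (Suc n)
  have "compact ((\<lambda>z. 1 / (real a + z)) ` cf4 n 1)" for a
    using cf4_bounds[of n] mu_bounds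
    by (intro compact_continuous_image[OF _ Suc] continuous_intros ballI)
       (auto dest!: subsetD)
  then show ?case by (auto intro!: compact_UN)
qed simp

lemma cf4_antimono: "m \<le> n \<Longrightarrow> cf4 n 1 \<subseteq> cf4 m 1"
proof (induction n rule: dec_induct)
  case (step n)
  have "cf4 (Suc n) 1 \<subseteq> cf4 n 1" for n
  proof (induction n)
    case 0
    then show ?case using cf4_bounds[of 1] mu_fixed by simp
  next
    case (Suc n)
    then have "(\<lambda>z. 1 / (real a + z)) ` cf4 (Suc n) 1 \<subseteq> (\<lambda>z. 1 / (real a + z)) ` cf4 n 1" for a
      by (rule image_mono)
    then show ?case unfolding cf4.simps(2)[of "Suc n"] cf4.simps(2)[of n 1] by (intro UN_mono) auto
  qed
  then show ?case using step by blast
qed simp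

definition F4 :: "real set" where
  "F4 = (\<Inter>n. cf4 n 1)"

lemma F4_bounds:
  assumes "x \<in> F4"
  shows "mu \<le> x \<and> x \<le> 4 * mu"
proof -
  have "x \<in> cf4 0 1" using assms unfolding F4_def by blast
  then have "x \<in> {mu..4 * mu}" using cf4_bounds by blast
  then show ?thesis by simp
qed

text \<open>
  \<open>F(4)\<close> is defined as an intersection, so at each level some digit \<open>a\<close> works; as there are only four
  digits and the levels decrease, one digit works for all levels.\<close>

lemma F4_gauss_map:
  assumes "x \<in> F4"
  shows "\<exists>a\<in>{1..4}. 1 / x - real a \<in> F4"
proof (rule ccontr)
  assume "\<not> ?thesis"
  then have "\<forall>a\<in>{1..4}. \<exists>n. 1 / x - real a \<notin> cf4 n 1" unfolding F4_def by blast
  then obtain N where N: "\<And>a. a \<in> {1..4} \<Longrightarrow> 1 / x - real a \<notin> cf4 (N a) 1" by metis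
  define M where "M = Max (N ` {1..4})"
  have "x \<in> cf4 (Suc M) 1" using assms by (auto simp: F4_def simp del: cf4.simps)
  then obtain a z where a: "a \<in> {1..4}" and z: "z \<in> cf4 M 1" "x = 1 / (real a + z)" by auto
  have "cf4 M 1 \<subseteq> cf4 (N a) 1" using a unfolding M_def by (intro cf4_antimono Max_ge) auto
  moreover have "1 / x - real a = z" using z by simp
  ultimately show False using N[OF a] z by auto
qed

lemma F4_product:
  fixes a b s :: real
  assumes ab: "5 \<le> a" "5 \<le> b" "\<bar>a - b\<bar> \<le> 1"
    and s: "(a + mu) * (b + mu) \<le> s" "s \<le> (a + 4 * mu) * (b + 4 * mu)"
  shows "\<exists>x\<in>F4. \<exists>y\<in>F4. (a + x) * (b + y) = s"
proof -
  define K where "K n = (cf4 n 1 \<times> cf4 n 1) \<inter> {p. (a + fst p) * (b + snd p) = s}" for n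
  have "compact (K n)" for n
    unfolding K_def by (intro compact_Int_closed compact_Times compact_cf4 closed_Collect_eq continuous_intros)
  moreover have "K n \<noteq> {}" for n
    using cf4_product_truncated[OF assms, of n] unfolding K_def by fastforce
  moreover have "K n \<subseteq> K m" if "m \<le> n" for m n
    using cf4_antimono[OF that] unfolding K_def by blast
  ultimately have "\<Inter> (range K) \<noteq> {}" by (rule compact_nest)
  then obtain x y where "\<And>n. (x, y) \<in> K n" by auto
  then have "x \<in> F4" "y \<in> F4" "(a + x) * (b + y) = s" by (auto simp: K_def F4_def)
  then show ?thesis by blast
qed

text \<open>
  With \<open>a\<close> maximal such that \<open>(a + mu)\<^sup>2 \<le> s\<close>, either the window of \<open>(a, a)\<close> contains \<open>s\<close>, or the
  window of \<open>(a, a + 1)\<close> bridges the distance to \<open>(a + 1 + mu)\<^sup>2\<close>.\<close>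

lemma product_windows_cover:
  assumes "(5 + mu)\<^sup>2 \<le> s"
  obtains a b :: nat where "5 \<le> a" "5 \<le> b" "\<bar>real a - real b\<bar> \<le> 1"
    "(real a + mu) * (real b + mu) \<le> s" "s \<le> (real a + 4 * mu) * (real b + 4 * mu)"
proof -
  have mu0: "0 < mu" using mu_bounds by simp
  have "0 \<le> s" using assms zero_le_power2[of "5 + mu"] by linarith
  define a where "a = nat \<lfloor>sqrt s - mu\<rfloor>"
  have "5 + mu \<le> sqrt s" using assms by (rule real_le_rsqrt)
  then have a5: "5 \<le> a" and a: "real a \<le> sqrt s - mu" "sqrt s - mu < real a + 1"
    unfolding a_def by linarith+
  have "(real a + mu)\<^sup>2 \<le> (sqrt s)\<^sup>2" using a mu0 by (intro power_mono) auto
  then have low: "(real a + mu) * (real a + mu) \<le> s" using \<open>0 \<le> s\<close> by (simp add: power2_eq_square)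
  have "(sqrt s)\<^sup>2 \<le> (real a + 1 + mu)\<^sup>2" using a \<open>0 \<le> s\<close> by (intro power_mono) auto
  then have high: "s \<le> (real a + 1 + mu)\<^sup>2" using \<open>0 \<le> s\<close> by simp
  have mua: "1/5 * real a \<le> mu * real a" using mu_bounds by (intro mult_right_mono) auto
  show thesis
  proof (cases "s \<le> (real a + 4 * mu) * (real a + 4 * mu)")
    case True
    then show ?thesis using that[of a a] a5 low by auto
  next
    case False
    have sq: "4 * (mu * mu) = 1 - 4 * mu" using mu_quadratic by (simp add: power2_eq_square)
    have "(real a + 4 * mu) * (real a + 4 * mu) - (real a + mu) * (real (a + 1) + mu) =
        6 * (mu * real a) + 15 * (mu * mu) - real a - mu"
      by (simp add: algebra_simps)
    then have "(real a + mu) * (real (a + 1) + mu) \<le> (real a + 4 * mu) * (real a + 4 * mu)"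
      using mua sq mu_bounds a5 by linarith
    moreover have "(real a + 4 * mu) * (real (a + 1) + 4 * mu) - (real a + 1 + mu)\<^sup>2 =
        6 * (mu * real a) - real a + 2 * mu + 15 * (mu * mu) - 1"
      by (simp add: algebra_simps power2_eq_square)
    then have "(real a + 1 + mu)\<^sup>2 \<le> (real a + 4 * mu) * (real (a + 1) + 4 * mu)"
      using mua sq mu_bounds a5 by linarith
    ultimately show ?thesis using that[of a "a + 1"] a5 False high by auto
  qed
qed

section \<open>Empty boxes along a continued fraction\<close>

text \<open>
  The closed box with half sides \<open>x\<close> and \<open>y\<close> contains no nonzero point of the lattice generated by
  \<open>(p, q)\<close> and \<open>(-r, u)\<close>.\<close>

definition lattice_free :: "real \<Rightarrow> real \<Rightarrow> real \<Rightarrow> real \<Rightarrow> real \<Rightarrow> real \<Rightarrow> bool" where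
  "lattice_free p q r u x y \<longleftrightarrow>
    (\<forall>m n. \<bar>of_int m * p - of_int n * r\<bar> \<le> x \<and> \<bar>of_int m * q + of_int n * u\<bar> \<le> y \<longrightarrow> m = 0 \<and> n = 0)"

text \<open>
  One step of the continued fraction replaces the basis by \<open>(-r, u)\<close> and \<open>(p, q) + a (-r, u)\<close>. A
  reflection in the vertical axis, which preserves the box, restores the sign pattern.\<close>

lemma lattice_free_step:
  assumes "lattice_free p q r u x y"
  shows "lattice_free r u (p - real a * r) (q + real a * u) x y"
  unfolding lattice_free_def
proof (intro allI impI)
  fix m n :: int
  assume *: "\<bar>m * r - n * (p - real a * r)\<bar> \<le> x \<and> \<bar>m * u + n * (q + real a * u)\<bar> \<le> y"
  have "real_of_int n * p - real_of_int (m + int a * n) * r = - (m * r - n * (p - real a * r))"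
    "real_of_int n * q + real_of_int (m + int a * n) * u = m * u + n * (q + real a * u)"
    by (simp_all add: algebra_simps)
  then have "\<bar>real_of_int n * p - real_of_int (m + int a * n) * r\<bar> \<le> x \<and>
      \<bar>real_of_int n * q + real_of_int (m + int a * n) * u\<bar> \<le> y"
    using * by (simp only: abs_minus_cancel)
  then have "n = 0 \<and> m + int a * n = 0"
    using assms unfolding lattice_free_def by blast
  then show "m = 0 \<and> n = 0" by auto
qed

text \<open>
  A quarter turn exchanges the roles of the two continued fractions, so that only one direction of the
  digit sequence has to be followed.\<close>

lemma lattice_free_rotate:
  assumes "lattice_free p q r u x y"
  shows "lattice_free u r q p y x"
  unfolding lattice_free_def
proof (intro allI impI)
  fix m n :: int
  assume *: "\<bar>m * u - n * q\<bar> \<le> y \<and> \<bar>m * r + n * p\<bar> \<le> x"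
  have "real_of_int (- n) * p - real_of_int m * r = - (m * r + n * p)"
    "real_of_int (- n) * q + real_of_int m * u = m * u - n * q"
    by (simp_all add: algebra_simps)
  then have "\<bar>real_of_int (- n) * p - real_of_int m * r\<bar> \<le> x \<and>
      \<bar>real_of_int (- n) * q + real_of_int m * u\<bar> \<le> y"
    using * by (simp only: abs_minus_cancel)
  then have "- n = 0 \<and> m = 0"
    using assms unfolding lattice_free_def by blast
  then show "m = 0 \<and> n = 0" by simp
qed

lemma lattice_free_height:
  assumes "lattice_free p q r u x y" "0 \<le> r" "r \<le> x" "0 < u"
  shows "y < u"
proof (rule ccontr)
  assume "\<not> y < u"
  then have "\<bar>(0::int) * p - (1::int) * r\<bar> \<le> x \<and> \<bar>(0::int) * q + (1::int) * u\<bar> \<le> y"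
    using assms by simp
  then have "(1::int) = 0" using assms(1) unfolding lattice_free_def by blast
  then show False by simp
qed

lemma box_bound:
  fixes p u s :: real
  assumes "p * u * (1 + t) = 1" "1 \<le> s * t" "0 < s" "0 < p" "0 < u" "0 < x" "x \<le> p" "0 < y" "y \<le> u"
  shows "x * y \<le> s / (s + 1)"
proof -
  have "p * u * (s + 1) \<le> p * u * (s + s * t)"
    using assms by (intro mult_left_mono) auto
  also have "\<dots> = s * (p * u * (1 + t))" by (simp add: algebra_simps)
  finally have "p * u * (s + 1) \<le> s" using assms(1) by simp
  then have "p * u \<le> s / (s + 1)" using assms by (simp add: field_simps)
  moreover have "x * y \<le> p * u" using assms by (intro mult_mono) auto
  ultimately show ?thesis by linarith
qed

text \<open>
  Once \<open>r/p = t\<close> lies in \<open>F(4)\<close>, no box narrower than \<open>p\<close> is large. If the box has width at least \<open>r\<close>,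
  the point \<open>(-r, u)\<close> limits its height, and \<open>p u = 1/(1 + t f)\<close> with \<open>f = q/u\<close>. Otherwise pass to
  the next basis: its \<open>t\<close> is at least \<open>mu\<close> and its \<open>f\<close> at least \<open>1/5\<close>, which already gives
  \<open>t f \<ge> 1/25 \<ge> 1/s\<close>. As \<open>t \<le> 4 mu < 5/6\<close>, the widths decrease geometrically and the
  descent stops.\<close>

lemma F4_tail_bound:
  fixes p q r u x y s t :: real
  assumes "lattice_free p q r u x y" "t \<in> F4" "r = t * p" "q = f * u" "0 \<le> f" "f \<le> 1"
    "p * u + q * r = 1" "1 \<le> s * (t * f)" "25 \<le> s"
    "0 < p" "0 < u" "0 < x" "0 < y" "x < p" "p * (5/6) ^ n \<le> x"
  shows "x * y \<le> s / (s + 1)"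
  using assms
proof (induction n arbitrary: p q r u t f)
  case 0
  then show ?case by simp
next
  case (Suc n)
  have t: "mu \<le> t" "t \<le> 4 * mu" using F4_bounds Suc.prems(2) by auto
  have r: "0 < r" "r \<le> 5/6 * p"
    using t mu_bounds Suc.prems(3,10) by auto
  show ?case
  proof (cases "r \<le> x")
    case True
    have "y < u" using lattice_free_height[OF Suc.prems(1) _ True] r Suc.prems by auto
    moreover have "p * u * (1 + t * f) = 1"
      using Suc.prems(3,4,7) by (simp add: algebra_simps)
    ultimately show ?thesis
      using Suc.prems by (intro box_bound[of p u "t * f"]) auto
  next
    case False
    obtain a where a: "a \<in> {1..4}" "1 / t - real a \<in> F4" using F4_gauss_map Suc.prems(2) by blast
    define t' f' where "t' = 1 / t - real a" and "f' = u / (q + real a * u)"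
    have t': "mu \<le> t'" using F4_bounds a by (auto simp: t'_def)
    have "q + real a * u = (f + real a) * u" using Suc.prems(4) by (simp add: algebra_simps)
    then have f': "f' = 1 / (f + real a)" using Suc.prems(11) by (simp add: f'_def)
    have f'_bounds: "1/5 \<le> f'" "f' \<le> 1" "0 \<le> f'"
      using Suc.prems(5,6) a unfolding f' by (auto simp: field_simps)
    have q': "0 < q + real a * u" using Suc.prems a by (simp add: add_nonneg_pos)
    show ?thesis
    proof (rule Suc.IH[of r u "p - real a * r" "q + real a * u" t' f'])
      show "lattice_free r u (p - real a * r) (q + real a * u) x y"
        by (rule lattice_free_step[OF Suc.prems(1)])
      show "t' \<in> F4" using a by (simp add: t'_def)
      show "p - real a * r = t' * r"
        using Suc.prems(3) t mu_bounds by (simp add: t'_def field_simps)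
      show "u = f' * (q + real a * u)" using q' by (simp add: f'_def)
      show "r * (q + real a * u) + u * (p - real a * r) = 1"
        using Suc.prems(7) by (simp add: algebra_simps)
      have "1/25 \<le> t' * f'"
        using mult_mono[of "1/5" t' "1/5" f'] t' f'_bounds mu_bounds by simp
      then show "1 \<le> s * (t' * f')"
        using mult_mono[of 25 s "1/25" "t' * f'"] Suc.prems by simp
      have "r * (5/6) ^ n \<le> 5/6 * p * (5/6) ^ n" using r by (intro mult_right_mono) auto
      also have "\<dots> = p * (5/6) ^ Suc n" by simp
      also have "\<dots> \<le> x" by (rule Suc.prems(15))
      finally show "r * (5/6) ^ n \<le> x" .
    qed (use f'_bounds r q' False Suc.prems in auto)
  qed
qed

text \<open>
  At the central basis \<open>p/r = a + v\<close> and \<open>u/q = b + w\<close>, so a box of width between \<open>r\<close> and \<open>p\<close> obeys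
  the bound exactly. For narrower boxes the first step away from the centre needs its own estimate,
  since one large digit is still involved: there \<open>t = v\<close>, and \<open>1/f\<close> is at most \<open>a + 1/5\<close>, whereas
  \<open>s v = (a + v) v (b + w)\<close> exceeds this because \<open>mu (5 + mu) \<ge> 1\<close>.\<close>

lemma centre_half_bound:
  fixes p q r u x y s v w :: real
  assumes free: "lattice_free p q r u x y" and vw: "v \<in> F4" "w \<in> F4" and ab: "5 \<le> a" "5 \<le> b"
    and s: "s = (real a + v) * (real b + w)"
    and r: "p = r * (real a + v)" and q: "u = q * (real b + w)" and unit: "p * u + q * r = 1"
    and pos: "0 < r" "0 < q" "0 < x" "0 < y" and "x < p"
  shows "x * y \<le> s / (s + 1)"
proof -
  have v: "mu \<le> v" and w: "mu \<le> w" using vw F4_bounds by auto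
  have av: "5 + mu \<le> real a + v" and bw: "5 + mu \<le> real b + w" using v w ab by auto
  have s25: "25 \<le> s"
    unfolding s using mult_mono[of 5 "real a + v" 5 "real b + w"] av bw mu_bounds by simp
  have pos': "0 < p" "0 < u" unfolding r q using pos av bw mu_bounds by auto
  show ?thesis
  proof (cases "r \<le> x")
    case True
    have "y < u" using lattice_free_height[OF free _ True] pos pos' by auto
    moreover have "p * u = q * r * s" unfolding s r q by (simp add: algebra_simps)
    then have "p * u * (1 + 1 / s) = 1" using unit s25 by (simp add: distrib_left)
    ultimately show ?thesis
      using s25 pos pos' \<open>x < p\<close> by (intro box_bound[of p u "1 / s"]) auto
  next
    case False
    define f where "f = u / (q + real a * u)"
    have qu: "q \<le> u / 5"
      using q bw pos mu_bounds mult_left_mono[of 5 "real b + w" q] by simp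
    have den: "0 < q + real a * u" using pos pos' by (simp add: add_pos_nonneg)
    have den_le: "q + real a * u \<le> (real a + 1/5) * u" using qu by (simp add: algebra_simps)
    have "1 * u \<le> real a * u" using ab pos' by (intro mult_right_mono) auto
    then have "u \<le> q + real a * u" using pos by linarith
    then have f: "0 \<le> f" "f \<le> 1"
      using pos pos' den by (simp_all add: f_def)
    have "1 / (real a + 1/5) = u / ((real a + 1/5) * u)"
      using pos' nonzero_divide_mult_cancel_right[of u "real a + 1/5"] by simp
    also have "\<dots> \<le> f" unfolding f_def using den den_le pos' by (intro divide_left_mono) auto
    finally have f_ge: "1 / (real a + 1/5) \<le> f" .
    have "1 \<le> mu * (5 + mu)" using mu_quadratic mu_bounds
      by (simp add: power2_eq_square distrib_left)
    also have "\<dots> \<le> v * (real b + w)" using v bw mu_bounds by (intro mult_mono) auto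
    finally have 1: "1 \<le> v * (real b + w)" .
    have cancel: "z * (1 / z) = 1" if "0 < z" for z :: real using that by simp
    have "(real a + 1/5) * 1 \<le> (real a + v) * (v * (real b + w))"
      using v mu_bounds 1 by (intro mult_mono) auto
    also have "\<dots> = s * v" by (simp add: s)
    finally have "(real a + 1/5) * (1 / (real a + 1/5)) \<le> (s * v) * f"
      using f_ge s25 v mu_bounds by (intro mult_mono) auto
    moreover have "(real a + 1/5) * (1 / (real a + 1/5)) = 1"
      by (rule cancel) simp
    ultimately have sv: "1 \<le> s * (v * f)" by (simp only: mult.assoc)
    obtain n where "(5/6) ^ n < x / r" using real_arch_pow_inv[of "x / r" "5/6"] pos by auto
    then have n: "r * (5/6) ^ n \<le> x" using pos by (simp add: field_simps)
    show ?thesis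
    proof (rule F4_tail_bound[OF lattice_free_step[OF free, of a] vw(1), of f s n])
      show "p - real a * r = v * r" using r by (simp add: algebra_simps)
      show "u = f * (q + real a * u)" using den by (simp add: f_def)
      show "r * (q + real a * u) + u * (p - real a * r) = 1"
        using unit by (simp add: algebra_simps)
    qed (use f sv s25 pos den False n in auto)
  qed
qed

section \<open>Mordell constants\<close>

text \<open>
  If the coefficients of a lattice point have equal signs, the second coordinate has no cancellation;
  if they have opposite signs, the first has none.\<close>

lemma lattice_free_basis_box:
  assumes "0 < p" "0 \<le> q" "0 \<le> r" "0 < u" "x < p" "y < u"
  shows "lattice_free p q r u x y"
  unfolding lattice_free_def
proof (intro allI impI)
  fix m n :: int
  assume *: "\<bar>m * p - n * r\<bar> \<le> x \<and> \<bar>m * q + n * u\<bar> \<le> y"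
  have large: "z \<le> \<bar>k * z\<bar>" if "k \<noteq> 0" "0 < z" for k :: int and z :: real
    using that mult_right_mono[of 1 "\<bar>real_of_int k\<bar>" z] by (simp add: abs_mult)
  have same_sign: "\<bar>a + b\<bar> = \<bar>a\<bar> + \<bar>b\<bar>" if "(0 \<le> a \<and> 0 \<le> b) \<or> (a \<le> 0 \<and> b \<le> 0)" for a b :: real
    using that by auto
  have "n = 0" if "m = 0" using large[of n u] * assms that by fastforce
  moreover have "m = 0" if "n = 0" using large[of m p] * assms that by fastforce
  moreover have False if "m \<noteq> 0" "n \<noteq> 0"
  proof (cases "(0 < m) = (0 < n)")
    case True
    then have "(0 \<le> m * q \<and> 0 \<le> n * u) \<or> (m * q \<le> 0 \<and> n * u \<le> 0)"
      using that assms by (cases "0 < m") (auto intro!: mult_nonneg_nonneg mult_nonpos_nonneg)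
    then have "\<bar>m * q + n * u\<bar> = \<bar>m * q\<bar> + \<bar>n * u\<bar>" by (rule same_sign)
    then show False using large[OF that(2) \<open>0 < u\<close>] * \<open>y < u\<close> abs_ge_zero[of "m * q"] by linarith
  next
    case False
    then have "(0 \<le> m * p \<and> 0 \<le> - (n * r)) \<or> (m * p \<le> 0 \<and> - (n * r) \<le> 0)"
      using that assms by (cases "0 < m") (auto intro!: mult_nonneg_nonneg mult_nonpos_nonneg)
    then have "\<bar>m * p + - (n * r)\<bar> = \<bar>m * p\<bar> + \<bar>- (n * r)\<bar>" by (rule same_sign)
    then show False using large[OF that(1) \<open>0 < p\<close>] * \<open>x < p\<close> abs_ge_zero[of "- (n * r)"] by linarith
  qed
  ultimately show "m = 0 \<and> n = 0" by blast
qed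

text \<open>
  The determinant condition makes the two generators independent, so that only the zero coefficients
  give the zero vector.\<close>

lemma admissible_iff_lattice_free:
  fixes p q r u :: real
  assumes "p * u + q * r = 1"
  shows "admissible (lattice_span (vector [p, q]) (vector [- r, u])) x y \<longleftrightarrow>
    0 < x \<and> 0 < y \<and> lattice_free p q r u x y"
proof -
  let ?v = "\<lambda>m n :: int. of_int m *\<^sub>R (vector [p, q] :: real^2) + of_int n *\<^sub>R vector [- r, u]"
  have mem: "?v m n \<in> rectangle x y \<longleftrightarrow> \<bar>m * p - n * r\<bar> \<le> x \<and> \<bar>m * q + n * u\<bar> \<le> y" for m n
    by (auto simp: rectangle_def mem_box_cart forall_2)
  have zero: "m = 0 \<and> n = 0" if "?v m n = 0" for m n
  proof -
    have e: "m * p - n * r = 0" "m * q + n * u = 0" using that by (auto simp: vec_eq_iff forall_2)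
    have "m * (p * u + q * r) = u * (m * p - n * r) + r * (m * q + n * u)"
      "n * (p * u + q * r) = p * (m * q + n * u) - q * (m * p - n * r)"
      by (simp_all add: algebra_simps)
    then show ?thesis unfolding e assms by simp
  qed
  have "rectangle x y \<inter> lattice_span (vector [p, q]) (vector [- r, u]) = {0} \<longleftrightarrow> lattice_free p q r u x y"
    if "0 < x" "0 < y"
  proof
    assume *: "rectangle x y \<inter> lattice_span (vector [p, q]) (vector [- r, u]) = {0}"
    show "lattice_free p q r u x y"
      unfolding lattice_free_def
    proof (intro allI impI)
      fix m n :: int
      assume "\<bar>m * p - n * r\<bar> \<le> x \<and> \<bar>m * q + n * u\<bar> \<le> y"
      then have "?v m n \<in> rectangle x y \<inter> lattice_span (vector [p, q]) (vector [- r, u])"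
        using mem by (auto simp: lattice_span_def)
      then have "?v m n = 0" using * by blast
      then show "m = 0 \<and> n = 0" by (rule zero)
    qed
  next
    assume *: "lattice_free p q r u x y"
    have "0 \<in> rectangle x y" using mem[of 0 0] that by simp
    moreover have "0 \<in> lattice_span (vector [p, q]) (vector [- r, u])"
      unfolding lattice_span_def by (intro CollectI exI[of _ 0]) simp
    moreover have "z = 0" if z: "z \<in> rectangle x y \<inter> lattice_span (vector [p, q]) (vector [- r, u])" for z
    proof -
      obtain m n where "z = ?v m n" using z by (auto simp: lattice_span_def)
      moreover from this have "m = 0 \<and> n = 0" using z mem * unfolding lattice_free_def by blast
      ultimately show ?thesis by simp
    qed
    ultimately show "rectangle x y \<inter> lattice_span (vector [p, q]) (vector [- r, u]) = {0}" by blast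
  qed
  then show ?thesis unfolding admissible_def by blast
qed

text \<open>
  Only boxes strictly smaller than \<open>p\<close> and \<open>u\<close> are known to be empty, so the supremum is approached
  through the half sides \<open>z p\<close> and \<open>w u\<close> with \<open>z, w < 1\<close>.\<close>

lemma basis_box_in_MG2:
  assumes unit: "p * u + q * r = 1" and pos: "0 < p" "0 \<le> q" "0 \<le> r" "0 < u"
    and bound: "\<And>x y. 0 < x \<Longrightarrow> 0 < y \<Longrightarrow> lattice_free p q r u x y \<Longrightarrow> x * y \<le> p * u"
  shows "p * u \<in> MG2"
proof -
  let ?\<Lambda> = "lattice_span (vector [p, q]) (vector [- r, u])"
  let ?S = "{x * y | x y. admissible ?\<Lambda> x y}"
  have in_S: "z * (w * (p * u)) \<in> ?S" if "0 < z" "z < 1" "0 < w" "w < 1" for z w :: real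
  proof -
    have "admissible ?\<Lambda> (z * p) (w * u)"
      unfolding admissible_iff_lattice_free[OF unit]
      using that pos by (auto intro!: lattice_free_basis_box)
    then have "\<exists>x y. z * (w * (p * u)) = x * y \<and> admissible ?\<Lambda> x y"
      by (intro exI[of _ "z * p"] exI[of _ "w * u"]) simp
    then show ?thesis by simp
  qed
  have upper: "t \<le> p * u" if "t \<in> ?S" for t
    using that bound by (auto simp: admissible_iff_lattice_free[OF unit])
  have "Sup ?S = p * u"
  proof (rule antisym)
    show "Sup ?S \<le> p * u" using in_S[of "1/2" "1/2"] upper by (intro cSup_least) auto
    have "bdd_above ?S" using upper by (rule bdd_aboveI)
    then have le: "z * (w * (p * u)) \<le> Sup ?S" if "0 < z" "z < 1" "0 < w" "w < 1" for z w :: real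
      using in_S[OF that] by (rule cSup_upper[rotated])
    have "w * (p * u) \<le> Sup ?S" if "0 < w" "w < 1" for w :: real
      by (rule field_le_mult_one_interval) (rule le[OF _ _ that])
    then show "p * u \<le> Sup ?S" by (rule field_le_mult_one_interval)
  qed
  moreover have "unimodular_lattice ?\<Lambda>"
    unfolding unimodular_lattice_def using unit
    by (intro exI[of _ "vector [p, q]"] exI[of _ "vector [- r, u]"]) (simp add: det_2)
  moreover from calculation have "p * u = mordell_constant ?\<Lambda>" by (simp add: mordell_constant_def)
  ultimately show ?thesis unfolding MG2_def by blast
qed

lemma one_in_MG2: "1 \<in> MG2"
proof -
  have "x * y \<le> 1" if "0 < x" "0 < y" and free: "lattice_free 1 0 0 1 x y" for x y
  proof -
    have "y < 1" using lattice_free_height[OF free] that by simp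
    moreover have "x < 1" using lattice_free_height[OF lattice_free_rotate[OF free]] that by simp
    ultimately show ?thesis using that mult_mono[of x 1 y 1] by simp
  qed
  then show ?thesis using basis_box_in_MG2[of 1 1 0 0] by simp
qed

text \<open>
  Scale the lattice so that \<open>p = 1\<close>; then \<open>r\<close>, \<open>q\<close> and \<open>u\<close> are determined by the two continued
  fractions and the determinant. A box is narrower than \<open>p\<close> or lower than \<open>u\<close>, and the second case is
  the first one after a quarter turn.\<close>

lemma product_ray_in_MG2:
  assumes "(5 + mu)\<^sup>2 \<le> s"
  shows "s / (s + 1) \<in> MG2"
proof -
  obtain a b :: nat where ab: "5 \<le> a" "5 \<le> b" "\<bar>real a - real b\<bar> \<le> 1"
    "(real a + mu) * (real b + mu) \<le> s" "s \<le> (real a + 4 * mu) * (real b + 4 * mu)"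
    using product_windows_cover[OF assms] .
  then obtain v w where vw: "v \<in> F4" "w \<in> F4" and s: "s = (real a + v) * (real b + w)"
    using F4_product[of "real a" "real b" s] by force
  have pos: "0 < real a + v" "0 < real b + w" using ab F4_bounds[OF vw(1)] F4_bounds[OF vw(2)] mu_bounds
    by linarith+
  then have s0: "0 < s" unfolding s by simp
  define r u q where "r = 1 / (real a + v)" and "u = s / (s + 1)" and "q = u / (real b + w)"
  have p: "1 = r * (real a + v)" and u: "u = q * (real b + w)" using pos by (auto simp: r_def q_def)
  have rq: "0 < r" "0 < q" "0 < u" using pos s0 by (auto simp: r_def q_def u_def)
  have "q * r = u / s" using pos by (simp add: q_def r_def s mult.commute)
  moreover have "u + u / s = u * (s + 1) / s" using s0 by (simp add: field_simps)
  moreover have "u * (s + 1) = s" using s0 by (simp add: u_def)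
  ultimately have unit: "1 * u + q * r = 1" using s0 by simp
  have "x * y \<le> 1 * u" if xy: "0 < x" "0 < y" and free: "lattice_free 1 q r u x y" for x y
  proof (cases "x < 1")
    case True
    have "x * y \<le> s / (s + 1)"
      by (rule centre_half_bound[OF free vw ab(1,2) s p u unit]) (use rq xy True in auto)
    then show ?thesis by (simp add: u_def)
  next
    case False
    have free': "lattice_free u r q 1 y x" by (rule lattice_free_rotate[OF free])
    have "q * 1 \<le> q * (real b + w)"
      using rq ab F4_bounds[OF vw(2)] mu_bounds by (intro mult_left_mono) auto
    then have "q \<le> u" using u by simp
    have "y < u"
    proof (rule ccontr)
      assume "\<not> y < u"
      then have "x < 1" using lattice_free_height[OF free'] rq \<open>q \<le> u\<close> by auto
      then show False using False by simp
    qed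
    have "y * x \<le> s / (s + 1)"
      by (rule centre_half_bound[OF free' vw(2,1) ab(2,1) _ u p])
         (use rq xy unit \<open>y < u\<close> s in \<open>auto simp: mult.commute\<close>)
    then show ?thesis by (simp add: u_def mult.commute)
  qed
  then have "1 * u \<in> MG2" using rq unit by (intro basis_box_in_MG2[of 1 u q r]) auto
  then show ?thesis by (simp add: u_def)
qed

theorem theorem32:
  shows "{(83 + 18 * sqrt 2) / (87 + 18 * sqrt 2) .. 1} \<subseteq> MG2"
proof
  fix c :: real
  assume c: "c \<in> {(83 + 18 * sqrt 2) / (87 + 18 * sqrt 2) .. 1}"
  show "c \<in> MG2"
  proof (cases "c = 1")
    case True
    then show ?thesis using one_in_MG2 by simp
  next
    case False
    then have c1: "0 < 1 - c" using c by simp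
    define s where "s = c / (1 - c)"
    have "0 < 87 + 18 * sqrt (2::real)" by (simp add: add_pos_nonneg)
    then have "83 + 18 * sqrt 2 \<le> c * (87 + 18 * sqrt 2)"
      using c by (simp add: pos_divide_le_eq)
    then have "(83 + 18 * sqrt 2) * (1 - c) \<le> 4 * c" by (simp add: algebra_simps)
    then have "(83 + 18 * sqrt 2) / 4 \<le> s" using c1 by (simp add: s_def field_simps)
    moreover have "(5 + mu)\<^sup>2 = (83 + 18 * sqrt 2) / 4"
      by (simp add: mu_def power2_eq_square field_simps)
    ultimately have "s / (s + 1) \<in> MG2" by (intro product_ray_in_MG2) simp
    moreover have "s / (s + 1) = c" using c1 by (simp add: s_def field_simps)
    ultimately show ?thesis by simp
  qed
qed

end
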